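(* Let $K$ be a field and $\mathbb{S}_1=K\langle x,y\mid yx=1\rangle$. Then: 1. ${}'\mathcal{C}_{\mathbb{S}_1}=\{y^{d(a)}a\mid a\in\mathbb{S}_1\setminus F\}$. 2. $\mathcal{C}'_{\mathbb{S}_1}=\eta({}'\mathcal{C}_{\mathbb{S}_1})$.
   Context: For a ring $R$, ${}'\mathcal{C}_R=\{c\in R\mid rc=0\Rightarrow r=0\}$ is the set of left regular elements and $\mathcal{C}'_R=\{c\in R\mid cr=0\Rightarrow r=0\}$ is the set of right regular elements. $F=\bigoplus_{i,j\ge0}KE_{ij}$ is the ideal of $\mathbb{S}_1$ spanned by the elements $E_{ij}:=x^iy^j-x^{i+1}y^{j+1}$, which satisfy $E_{ij}E_{kl}=\delta_{jk}E_{il}$. For $a\in\mathbb{S}_1\setminus F$, $d(a):=\min\{i\in\mathbb{N}\mid y^ia\in{}'\mathcal{C}_{\mathbb{S}_1}\}$, where $\mathbb{N}=\{0,1,2,\ldots\}$ (the set over which the minimum is taken is nonempty). $\eta$ is the $K$-algebra anti-automorphism of $\mathbb{S}_1$ with $\eta(x)=y$, $\eta(y)=x$. *)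

theory Defs
  imports Complex_Main "HOL-Library.Poly_Mapping"
begin

datatype letter = X | Y

text \<open>The free monoid on two letters, written additively because the convolution product of
  \<^typ>\<open>'a \<Rightarrow>\<^sub>0 'b\<close> is defined over additive monoids.\<close>

datatype xyword = Wd (letters: "letter list")

instantiation xyword :: monoid_add
begin
definition zero_xyword :: xyword where "0 = Wd []"
definition plus_xyword :: "xyword \<Rightarrow> xyword \<Rightarrow> xyword"
  where "u + v = Wd (letters u @ letters v)"
instance by standard (auto simp: zero_xyword_def plus_xyword_def)
end

text \<open>The free associative algebra \<open>K\<langle>x,y\<rangle>\<close> is the monoid algebra of the free monoid.\<close>

type_synonym 'k free_xy = "xyword \<Rightarrow>\<^sub>0 'k"

abbreviation mon :: "letter list \<Rightarrow> 'k::field \<Rightarrow> 'k free_xy"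
  where "mon w c \<equiv> Poly_Mapping.single (Wd w) c"

lemma mon_mult: "mon u c * mon v d = mon (u @ v) (c * d)"
  by (simp add: Poly_Mapping.mult_single plus_xyword_def)

lemma mon_Nil_1: "mon [] 1 = 1"
  by (metis zero_xyword_def single_one)

lemma free_xy_induct [case_names mon add]:
  assumes "\<And>w c. P (mon w c)" and "\<And>p q. P p \<Longrightarrow> P q \<Longrightarrow> P (p + q)"
  shows "P (p :: 'k::field free_xy)"
proof (induction p rule: Poly_Mapping.update_induct)
  case const
  show ?case using assms(1)[of "[]" 0] by (simp add: zero_xyword_def)
next
  case (update f a b)
  have "Poly_Mapping.update a b f = f + Poly_Mapping.single a b"
    using update by (intro poly_mapping_eqI)
      (auto simp: lookup_update lookup_add lookup_single when_def in_keys_iff)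
  then show ?case using assms update by (metis xyword.exhaust)
qed

text \<open>The two-sided ideal generated by \<open>yx - 1\<close>.\<close>

inductive_set rel_ideal :: "'k::field free_xy set" where
  gen: "mon [Y, X] 1 - 1 \<in> rel_ideal"
| zero: "0 \<in> rel_ideal"
| add: "p \<in> rel_ideal \<Longrightarrow> q \<in> rel_ideal \<Longrightarrow> p + q \<in> rel_ideal"
| left: "p \<in> rel_ideal \<Longrightarrow> r * p \<in> rel_ideal"
| right: "p \<in> rel_ideal \<Longrightarrow> p * r \<in> rel_ideal"

lemma rel_ideal_uminus: "p \<in> rel_ideal \<Longrightarrow> - p \<in> rel_ideal"
  using rel_ideal.left[of p "-1"] by simp

lemma rel_ideal_diff: "p \<in> rel_ideal \<Longrightarrow> q \<in> rel_ideal \<Longrightarrow> p - q \<in> rel_ideal"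
  using rel_ideal.add[of p "-q"] rel_ideal_uminus[of q] by simp

text \<open>The ideal is proper: the augmentation \<open>x, y \<mapsto> 1\<close> kills it.\<close>

definition augment :: "'k::field free_xy \<Rightarrow> 'k"
  where "augment p = (\<Sum>w\<in>Poly_Mapping.keys p. Poly_Mapping.lookup p w)"

lemma augment_add: "augment (p + q) = augment p + augment q"
proof -
  let ?S = "Poly_Mapping.keys p \<union> Poly_Mapping.keys q"
  have *: "augment r = (\<Sum>w\<in>?S. Poly_Mapping.lookup r w)"
    if "Poly_Mapping.keys r \<subseteq> ?S" for r
    unfolding augment_def
    by (rule sum.mono_neutral_left) (use that in \<open>auto simp: in_keys_iff\<close>)
  show ?thesis
    by (subst (1 2 3) *) (auto simp: lookup_add sum.distrib dest: Poly_Mapping.keys_add[THEN subsetD])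
qed

lemma augment_mon: "augment (mon w c) = c"
  by (simp add: augment_def)

lemma augment_mult: "augment (p * q) = augment p * augment q"
proof (induction p rule: free_xy_induct)
  case (mon w c)
  show ?case
    by (induction q rule: free_xy_induct)
      (simp_all add: mon_mult augment_mon augment_add distrib_left)
qed (simp add: augment_add distrib_right)

lemma augment_1: "augment 1 = 1"
  by (metis augment_mon mon_Nil_1)

lemma augment_rel_ideal: "p \<in> rel_ideal \<Longrightarrow> augment p = 0"
proof (induction rule: rel_ideal.induct)
  case gen
  have "augment (mon [Y, X] (1::'a) - 1) + augment 1 = augment (mon [Y, X] (1::'a))"
    by (simp flip: augment_add)
  then show ?case by (simp add: augment_mon augment_1)
qed (simp_all add: augment_add augment_mult, simp add: augment_def)

text \<open>The algebra \<open>\<S>\<^sub>1 = K\<langle>x, y | yx = 1\<rangle>\<close>.\<close>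

definition S1_rel :: "'k::field free_xy \<Rightarrow> 'k free_xy \<Rightarrow> bool"
  where "S1_rel p q \<longleftrightarrow> p - q \<in> rel_ideal"

lemma equivp_S1_rel: "equivp S1_rel"
proof (rule equivpI)
  show "reflp S1_rel" by (simp add: reflp_def S1_rel_def rel_ideal.zero)
  show "symp S1_rel"
    by (metis S1_rel_def minus_diff_eq rel_ideal_uminus sympI)
  show "transp S1_rel"
    unfolding transp_def S1_rel_def
    by (metis (no_types, lifting) rel_ideal.add diff_add_cancel add_diff_eq)
qed

quotient_type (overloaded) 'k S1 = "'k::field free_xy" / S1_rel
  by (rule equivp_S1_rel)

instantiation S1 :: (field) ring_1
begin
lift_definition zero_S1 :: "'a S1" is 0 .
lift_definition one_S1 :: "'a S1" is 1 .
lift_definition plus_S1 :: "'a S1 \<Rightarrow> 'a S1 \<Rightarrow> 'a S1" is "(+)"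
  unfolding S1_rel_def by (metis add_diff_add rel_ideal.add)
lift_definition uminus_S1 :: "'a S1 \<Rightarrow> 'a S1" is uminus
  unfolding S1_rel_def by (metis minus_diff_minus rel_ideal_uminus)
lift_definition minus_S1 :: "'a S1 \<Rightarrow> 'a S1 \<Rightarrow> 'a S1" is "(-)"
proof -
  fix p p' q q' :: "'a free_xy"
  assume "S1_rel p p'" "S1_rel q q'"
  then have "(p - p') - (q - q') \<in> rel_ideal"
    unfolding S1_rel_def by (rule rel_ideal_diff)
  then show "S1_rel (p - q) (p' - q')" by (simp add: S1_rel_def algebra_simps)
qed
lift_definition times_S1 :: "'a S1 \<Rightarrow> 'a S1 \<Rightarrow> 'a S1" is "(*)"
proof -
  fix p p' q q' :: "'a free_xy"
  assume "S1_rel p p'" "S1_rel q q'"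
  then have "(p - p') * q + p' * (q - q') \<in> rel_ideal"
    unfolding S1_rel_def by (intro rel_ideal.intros)
  then show "S1_rel (p * q) (p' * q')" by (simp add: S1_rel_def algebra_simps)
qed
instance
proof
  have "(1::'a free_xy) \<notin> rel_ideal"
    using augment_rel_ideal[of "1::'a free_xy"] by (auto simp: augment_1)
  then show "(0::'a S1) \<noteq> 1"
    by transfer (use rel_ideal_uminus[of "- 1"] in \<open>auto simp: S1_rel_def\<close>)
qed (transfer; simp add: S1_rel_def algebra_simps rel_ideal.zero)+
end

lift_definition S1_x :: "'k::field S1" is "mon [X] 1" .
lift_definition S1_y :: "'k::field S1" is "mon [Y] 1" .
lift_definition S1_scale :: "'k::field \<Rightarrow> 'k S1 \<Rightarrow> 'k S1" is "\<lambda>c p. mon [] c * p"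
  unfolding S1_rel_def by (metis right_diff_distrib rel_ideal.left)

lemma S1_yx: "S1_y * S1_x = (1 :: 'k::field S1)"
  by transfer (simp add: S1_rel_def mon_mult rel_ideal.gen)

global_interpretation S1: vector_space "S1_scale :: 'k::field \<Rightarrow> 'k S1 \<Rightarrow> 'k S1"
proof
  fix a b :: 'k and u v :: "'k S1"
  show "S1_scale a (u + v) = S1_scale a u + S1_scale a v"
    by transfer (simp add: S1_rel_def distrib_left rel_ideal.zero)
  show "S1_scale (a + b) u = S1_scale a u + S1_scale b u"
    by transfer (simp add: S1_rel_def distrib_right rel_ideal.zero single_add)
  show "S1_scale a (S1_scale b u) = S1_scale (a * b) u"
    by transfer (simp add: S1_rel_def rel_ideal.zero mon_mult flip: mult.assoc)
  show "S1_scale 1 u = u"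
    by transfer (simp add: S1_rel_def rel_ideal.zero mon_Nil_1)
qed

lemma mon_Nil_central: "mon [] c * p = p * mon [] c"
  by (induction p rule: free_xy_induct) (simp_all add: mon_mult distrib_left distrib_right mult.commute)

lemma S1_scale_mult_left: "S1_scale c a * b = S1_scale c (a * b)"
  by transfer (simp add: S1_rel_def rel_ideal.zero mult.assoc)

lemma S1_scale_mult_right: "a * S1_scale c b = S1_scale c (a * b)"
  by transfer (metis S1_rel_def cancel_comm_monoid_add_class.diff_cancel mon_Nil_central mult.assoc rel_ideal.zero)

definition left_regular :: "'a::ring set"
  where "left_regular = {c. \<forall>r. r * c = 0 \<longrightarrow> r = 0}"

definition right_regular :: "'a::ring set"
  where "right_regular = {c. \<forall>r. c * r = 0 \<longrightarrow> r = 0}"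

definition S1_E :: "nat \<Rightarrow> nat \<Rightarrow> 'k::field S1"
  where "S1_E i j = S1_x ^ i * S1_y ^ j - S1_x ^ (i + 1) * S1_y ^ (j + 1)"

definition S1_F :: "'k::field S1 set"
  where "S1_F = S1.span {S1_E i j | i j. True}"

text \<open>Only meaningful for \<open>a \<notin> S1_F\<close>.\<close>

definition S1_d :: "'k::field S1 \<Rightarrow> nat"
  where "S1_d a = (LEAST i. S1_y ^ i * a \<in> left_regular)"

text \<open>The map \<open>\<eta>\<close> is induced by the anti-automorphism of the free algebra that reverses every word
  and interchanges the two letters. As \<open>rev_swap\<close> is an involution, pulling coefficients back
  along it is the same as pushing words forward. The lemmas below identify \<open>\<eta>\<close> as the unique
  \<open>K\<close>-algebra anti-automorphism with \<open>x \<mapsto> y\<close> and \<open>y \<mapsto> x\<close>.\<close>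

fun swap_letter :: "letter \<Rightarrow> letter" where
  "swap_letter X = Y"
| "swap_letter Y = X"

definition rev_swap :: "xyword \<Rightarrow> xyword"
  where "rev_swap w = Wd (rev (map swap_letter (letters w)))"

lemma swap_letter_swap [simp]: "swap_letter (swap_letter l) = l"
  by (cases l) auto

lemma rev_swap_rev_swap [simp]: "rev_swap (rev_swap w) = w"
  by (cases w) (simp add: rev_swap_def rev_map comp_def)

lemma inj_rev_swap: "inj rev_swap"
  by (metis injI rev_swap_rev_swap)

definition free_eta :: "'k::field free_xy \<Rightarrow> 'k free_xy"
  where "free_eta p = Poly_Mapping.map_key rev_swap p"

lemma free_eta_mon: "free_eta (mon w c) = mon (rev (map swap_letter w)) c"
  unfolding free_eta_def
  using map_key_single[OF inj_rev_swap, of "rev_swap (Wd w)" c]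
  by (simp) (simp add: rev_swap_def)

lemma free_eta_add: "free_eta (p + q) = free_eta p + free_eta q"
  by (simp add: free_eta_def map_key_plus[OF inj_rev_swap])

lemma free_eta_0: "free_eta 0 = 0"
  by (metis free_eta_add add_cancel_right_right)

lemma free_eta_diff: "free_eta (p - q) = free_eta p - free_eta q"
  by (metis free_eta_add diff_add_cancel add_diff_cancel_right')

lemma free_eta_mult: "free_eta (p * q) = free_eta q * free_eta p"
proof (induction p rule: free_xy_induct)
  case (mon w c)
  show ?case
    by (induction q rule: free_xy_induct)
      (simp_all add: mon_mult free_eta_mon free_eta_add distrib_left distrib_right mult.commute)
qed (simp add: free_eta_add distrib_left distrib_right)

lemma free_eta_free_eta: "free_eta (free_eta p) = p"
  by (induction p rule: free_xy_induct)
    (simp_all add: free_eta_mon free_eta_add rev_map comp_def)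

lemma free_eta_1: "free_eta 1 = 1"
  using free_eta_mon[of "[]" 1] by (simp add: mon_Nil_1)

lemma free_eta_rel_ideal: "p \<in> rel_ideal \<Longrightarrow> free_eta p \<in> rel_ideal"
  by (induction rule: rel_ideal.induct)
    (auto simp: free_eta_diff free_eta_add free_eta_mult free_eta_mon free_eta_1 free_eta_0
      intro: rel_ideal.intros)

lift_definition S1_eta :: "'k::field S1 \<Rightarrow> 'k S1" is free_eta
  unfolding S1_rel_def by (metis free_eta_diff free_eta_rel_ideal)

definition S1_anti_automorphism :: "('k::field S1 \<Rightarrow> 'k S1) \<Rightarrow> bool"
  where "S1_anti_automorphism f \<longleftrightarrow>
    bij f \<and> (\<forall>a b. f (a + b) = f a + f b) \<and> (\<forall>c a. f (S1_scale c a) = S1_scale c (f a)) \<and>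
    f 1 = 1 \<and> (\<forall>a b. f (a * b) = f b * f a)"

lemma S1_eta_S1_eta: "S1_eta (S1_eta a) = a"
  by transfer (simp add: free_eta_free_eta S1_rel_def rel_ideal.zero)

lemma S1_eta_anti_automorphism: "S1_anti_automorphism S1_eta"
  unfolding S1_anti_automorphism_def
proof (intro conjI allI)
  show "bij (S1_eta :: 'a S1 \<Rightarrow> _)" by (metis S1_eta_S1_eta involuntory_imp_bij)
  fix a b :: "'a S1" and c
  show "S1_eta (a + b) = S1_eta a + S1_eta b"
    by transfer (simp add: free_eta_add S1_rel_def rel_ideal.zero)
  show "S1_eta (a * b) = S1_eta b * S1_eta a"
    by transfer (simp add: free_eta_mult S1_rel_def rel_ideal.zero)
  show "S1_eta (S1_scale c a) = S1_scale c (S1_eta a)"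
    by transfer (simp add: free_eta_mult free_eta_mon mon_Nil_central S1_rel_def rel_ideal.zero)
  show "S1_eta (1 :: 'a S1) = 1"
    by transfer (simp add: free_eta_1 S1_rel_def rel_ideal.zero)
qed

lemma S1_eta_x: "S1_eta S1_x = S1_y" and S1_eta_y: "S1_eta S1_y = S1_x"
  by (transfer, simp add: free_eta_mon S1_rel_def rel_ideal.zero)+

lemma S1_induct [case_names one x y mult add scale]:
  assumes one: "P 1" and x: "P S1_x" and y: "P S1_y"
    and mult: "\<And>a b. P a \<Longrightarrow> P b \<Longrightarrow> P (a * b)" and add: "\<And>a b. P a \<Longrightarrow> P b \<Longrightarrow> P (a + b)"
    and scale: "\<And>c a. P a \<Longrightarrow> P (S1_scale c a)"
  shows "P (a :: 'k::field S1)"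
proof -
  have word: "P (abs_S1 (mon w 1))" for w
  proof (induction w)
    case Nil
    show ?case using one by (simp add: mon_Nil_1 one_S1_def)
  next
    case (Cons l w)
    have "abs_S1 (mon (l # w) (1::'k)) = abs_S1 (mon [l] 1) * abs_S1 (mon w 1)"
      by (simp add: times_S1.abs_eq mon_mult)
    moreover have "P (abs_S1 (mon [l] 1))"
      using x y by (cases l) (simp_all add: S1_x_def S1_y_def)
    ultimately show ?case using mult Cons by simp
  qed
  have "P (abs_S1 p)" for p
  proof (induction p rule: free_xy_induct)
    case (mon w c)
    show ?case using scale[OF word, of c w] by (simp add: S1_scale.abs_eq mon_mult)
  next
    case (add p q)
    then show ?case using assms(5) by (simp flip: plus_S1.abs_eq)
  qed
  then show ?thesis by (metis Quotient_S1 Quotient_abs_rep)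
qed

lemma S1_eta_unique:
  assumes f: "S1_anti_automorphism f" and fx: "f S1_x = S1_y" and fy: "f S1_y = S1_x"
  shows "f = S1_eta"
proof
  fix a :: "'a S1"
  note * = f[unfolded S1_anti_automorphism_def]
    S1_eta_anti_automorphism[where 'a = 'a, unfolded S1_anti_automorphism_def]
  show "f a = S1_eta a"
  proof (induction a rule: S1_induct)
    case one show ?case using * by simp
  next
    case x show ?case by (simp add: fx S1_eta_x)
  next
    case y show ?case by (simp add: fy S1_eta_y)
  next
    case (mult a b) then show ?case using * by metis
  next
    case (add a b) then show ?case using * by metis
  next
    case (scale c a) then show ?case using * by metis
  qed
qed

end

(*
  Write e = 1 - x y, so y e = e x = 0.  For every a there is N with y^N a in K[y], and the
  telescoping sum a - x^N y^N a = \<Sum>k<N. x^k e y^k a lies in F; hence y^N a is a nonzero polynomial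
  in y whenever a is not in F.  A nonzero polynomial p(y) is left regular: if r \<noteq> 0 then the same sum
  gives k with e y^k r \<noteq> 0, and this element is e g(y) for some polynomial g \<noteq> 0, so
  e y^k r p(y) = e (g p)(y) \<noteq> 0.  The last step holds because right multiplication by x^(deg f) turns
  e f(y) into the leading coefficient of f times e, and e \<noteq> 0.  Conversely every element of F is
  killed from the left by a power of y, so left regular elements c lie outside F, and d(c) = 0.
*)
theory Submission
  imports Defs "HOL-Computational_Algebra.Polynomial"
begin

section \<open>The element \<open>1 - xy\<close> is nonzero\<close>

text \<open>The letters act on the basis \<open>1, x, x\<^sup>2, \<dots>\<close> of \<open>K[x]\<close>, with \<open>y\<close> the left shift; \<^const>\<open>None\<close>
  stands for the zero vector.\<close>

fun letter_act :: "letter \<Rightarrow> nat option \<Rightarrow> nat option" where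
  "letter_act X (Some n) = Some (Suc n)"
| "letter_act Y (Some (Suc n)) = Some n"
| "letter_act _ _ = None"

definition fixes_one :: "xyword \<Rightarrow> bool"
  where "fixes_one w \<longleftrightarrow> foldr letter_act (letters w) (Some 0) = Some 0"

text \<open>The coefficient of \<open>1\<close> in \<open>p \<cdot> 1\<close>.\<close>

definition const_coeff :: "'k::field free_xy \<Rightarrow> 'k" where
  "const_coeff p = (\<Sum>w\<in>Poly_Mapping.keys p. if fixes_one w then Poly_Mapping.lookup p w else 0)"

lemma const_coeff_add: "const_coeff (p + q) = const_coeff p + const_coeff q"
proof -
  let ?S = "Poly_Mapping.keys p \<union> Poly_Mapping.keys q"
  have *: "const_coeff r = (\<Sum>w\<in>?S. if fixes_one w then Poly_Mapping.lookup r w else 0)"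
    if "Poly_Mapping.keys r \<subseteq> ?S" for r
    unfolding const_coeff_def
    by (rule sum.mono_neutral_left) (use that in \<open>auto simp: in_keys_iff\<close>)
  show ?thesis
    by (subst (1 2 3) *)
      (auto simp: lookup_add sum.distrib[symmetric] intro!: sum.cong
        dest: Poly_Mapping.keys_add[THEN subsetD])
qed

lemma const_coeff_mon: "const_coeff (mon w c) = (if fixes_one (Wd w) then c else 0)"
  by (simp add: const_coeff_def)

lemma const_coeff_0: "const_coeff 0 = 0"
  by (simp add: const_coeff_def)

lemma const_coeff_diff: "const_coeff (p - q) = const_coeff p - const_coeff q"
  by (metis const_coeff_add diff_add_cancel add_diff_cancel_right')

lemma letter_act_YX: "letter_act Y (letter_act X s) = s"
  by (cases s) auto

text \<open>For monomials \<open>u\<close>, \<open>v\<close> the two resulting words differ only by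
  an inserted \<open>[Y, X]\<close>, which acts as the identity.\<close>

lemma const_coeff_relator: "const_coeff (u * (mon [Y, X] 1 - 1) * v) = 0"
proof (induction u rule: free_xy_induct)
  case (mon w c)
  show ?case
  proof (induction v rule: free_xy_induct)
    case (mon w' c')
    have "mon w c * (mon [Y, X] 1 - 1) * mon w' c'
        = mon (w @ [Y, X] @ w') (c * c') - mon (w @ w') (c * c')"
      by (simp add: right_diff_distrib left_diff_distrib mon_mult)
    then show ?case
      by (simp add: const_coeff_diff const_coeff_mon fixes_one_def letter_act_YX)
  qed (simp add: distrib_left const_coeff_add)
qed (simp add: distrib_right const_coeff_add)

lemma const_coeff_rel_ideal:
  assumes "p \<in> rel_ideal" shows "const_coeff p = 0"
proof -
  \<comment> \<open>\<open>const_coeff\<close> is not multiplicative, so the induction has to carry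
    arbitrary multipliers on both sides.\<close>
  have "const_coeff (u * p * v) = 0" for u v
    using assms
  proof (induction arbitrary: u v rule: rel_ideal.induct)
    case (left p r)
    then show ?case by (metis mult.assoc)
  next
    case (right p r)
    then show ?case by (metis mult.assoc)
  qed (simp_all add: const_coeff_relator const_coeff_0 distrib_left distrib_right const_coeff_add)
  from this[of 1 1] show ?thesis by simp
qed

definition S1_e :: "'k::field S1"
  where "S1_e = 1 - S1_x * S1_y"

lemma S1_e_nonzero: "S1_e \<noteq> (0 :: 'k::field S1)"
proof
  assume "S1_e = (0 :: 'k S1)"
  then have "1 - mon [X] 1 * mon [Y] 1 \<in> (rel_ideal :: 'k free_xy set)"
    unfolding S1_e_def by transfer (simp add: S1_rel_def)
  then have "const_coeff (mon [] 1 - mon [X, Y] 1 :: 'k free_xy) = 0"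
    by (intro const_coeff_rel_ideal) (simp add: mon_mult mon_Nil_1)
  \<comment> \<open>\<open>Y\<close> sends \<open>Some 0\<close> to \<open>None\<close>, so the word
    \<open>[X, Y]\<close> contributes 0 and the coefficient is 1.\<close>
  then show False
    by (simp add: const_coeff_diff const_coeff_mon fixes_one_def)
qed

section \<open>Identities between \<open>x\<close>, \<open>y\<close> and \<open>e\<close>\<close>

lemma S1_yx_assoc: "S1_y * (S1_x * a) = (a :: 'k::field S1)"
  by (metis S1_yx mult.assoc mult_1)

lemma S1_y_power_x_power: "S1_y ^ n * S1_x ^ n = (1 :: 'k::field S1)"
proof (induction n)
  case (Suc n)
  have "S1_y ^ Suc n * S1_x ^ Suc n = S1_y ^ n * (S1_y * (S1_x * S1_x ^ n) :: 'k S1)"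
    by (metis power_Suc power_Suc2 mult.assoc)
  then show ?case using Suc by (simp only: S1_yx_assoc)
qed simp

lemma S1_y_e: "S1_y * S1_e = (0 :: 'k::field S1)"
  by (simp add: S1_e_def right_diff_distrib S1_yx_assoc)

lemma S1_e_x: "S1_e * S1_x = (0 :: 'k::field S1)"
  by (simp add: S1_e_def left_diff_distrib mult.assoc S1_yx)

lemma S1_e_x_assoc: "S1_e * (S1_x * a) = (0 :: 'k::field S1)"
  by (metis S1_e_x mult.assoc mult_zero_left)

lemma S1_E_eq: "S1_E i j = S1_x ^ i * S1_e * (S1_y ^ j :: 'k::field S1)"
  by (simp add: S1_E_def S1_e_def power_Suc2 right_diff_distrib left_diff_distrib mult.assoc
      flip: power_commutes)

lemma S1_telescope:
  "a - S1_x ^ n * (S1_y ^ n * a) = (\<Sum>k<n. S1_x ^ k * (S1_e * (S1_y ^ k * a)) :: 'k::field S1)"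
proof (induction n)
  case (Suc n)
  have "S1_x ^ Suc n * (S1_y ^ Suc n * a) = S1_x ^ n * (S1_x * (S1_y * (S1_y ^ n * a)))"
    by (metis power_Suc power_Suc2 mult.assoc)
  then have "S1_x ^ n * (S1_e * (S1_y ^ n * a))
      = S1_x ^ n * (S1_y ^ n * a) - S1_x ^ Suc n * (S1_y ^ Suc n * a)"
    by (simp add: S1_e_def right_diff_distrib left_diff_distrib mult.assoc del: power_Suc)
  then show ?case
    by (simp only: sum.lessThan_Suc diff_add_cancel add_diff_eq flip: Suc)
qed simp

section \<open>Polynomials in \<open>y\<close>\<close>

text \<open>Horner evaluation at y, with \<open>S1_y\<close> on the right so that a subsequent
  factor \<open>S1_x\<close> cancels it.\<close>

definition poly_y :: "'k::field poly \<Rightarrow> 'k S1"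
  where "poly_y p = fold_coeffs (\<lambda>c a. S1_scale c 1 + a * S1_y) p 0"

lemma poly_y_0 [simp]: "poly_y 0 = 0"
  by (simp add: poly_y_def)

lemma poly_y_pCons [simp]: "poly_y (pCons c p) = S1_scale c 1 + poly_y p * S1_y"
  by (cases "p = 0"; cases "c = 0") (simp_all add: poly_y_def)

lemma poly_y_add: "poly_y (p + q) = poly_y p + poly_y q"
  by (induction p q rule: poly_induct2)
    (simp_all add: S1.scale_left_distrib distrib_right algebra_simps)

lemma poly_y_smult: "poly_y (smult c p) = S1_scale c (poly_y p)"
  by (induction p) (simp_all add: S1.scale_right_distrib S1_scale_mult_left)

lemma poly_y_commute: "poly_y p * S1_y = S1_y * poly_y p"
proof (induction p)
  case (pCons c p)
  then have "poly_y p * S1_y * S1_y = S1_y * (poly_y p * S1_y)"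
    by (simp add: mult.assoc)
  then show ?case
    by (simp add: distrib_left distrib_right S1_scale_mult_left S1_scale_mult_right)
qed simp

lemma poly_y_mult: "poly_y (p * q) = poly_y p * poly_y q"
proof (induction p)
  case (pCons c p)
  have "poly_y (p * q) * S1_y = poly_y p * S1_y * poly_y q"
    using pCons by (metis mult.assoc poly_y_commute)
  then show ?case
    by (simp add: poly_y_add poly_y_smult distrib_right S1_scale_mult_left)
qed simp

lemma poly_y_power_commute: "S1_y ^ n * poly_y p = poly_y p * S1_y ^ n"
  by (simp add: power_commuting_commutes poly_y_commute)

lemma poly_y_monom: "poly_y (monom 1 n) = S1_y ^ n"
  by (induction n) (simp_all add: monom_0 monom_Suc flip: power_commutes)

text \<open>Each factor \<open>S1_x\<close> removes the constant term through e x = 0 and lowers the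
  degree through y x = 1.\<close>

lemma S1_e_poly_y_leading:
  "S1_e * (poly_y p * S1_x ^ degree p) = S1_scale (lead_coeff p) S1_e"
proof (induction p)
  case (pCons c p)
  show ?case
  proof (cases "p = 0")
    case False
    then show ?thesis using pCons.IH
      by (simp add: distrib_left distrib_right S1_scale_mult_left S1_scale_mult_right
          S1_e_x_assoc mult.assoc S1_yx_assoc)
  qed (simp add: S1_scale_mult_right)
qed simp

lemma S1_e_poly_y_eq_0_iff: "S1_e * poly_y p = 0 \<longleftrightarrow> p = 0"
proof
  assume "S1_e * poly_y p = 0"
  then have "S1_scale (lead_coeff p) S1_e = 0"
    by (metis S1_e_poly_y_leading mult.assoc mult_zero_left)
  then show "p = 0" by (simp add: S1_e_nonzero)
qed simp

lemma S1_e_mult_eq_poly_y: "\<exists>g. S1_e * a = S1_e * poly_y g"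
proof -
  \<comment> \<open>For all \<open>g\<close> together this says that right multiplication by
    \<open>a\<close> preserves e K[y], a property inherited by products; g = 1 gives the
    goal.\<close>
  have "\<exists>h. S1_e * poly_y g * a = S1_e * poly_y h" for g
  proof (induction a arbitrary: g rule: S1_induct)
    case one
    show ?case by auto
  next
    case x
    show ?case
    proof (cases g)
      case (pCons c h)
      have "S1_e * poly_y g * S1_x = S1_e * poly_y h"
        by (simp add: pCons distrib_left distrib_right S1_scale_mult_left S1_scale_mult_right
            mult.assoc S1_yx S1_e_x)
      then show ?thesis by blast
    qed
  next
    case y
    have "S1_e * poly_y g * S1_y = S1_e * poly_y (pCons 0 g)"
      by (simp add: mult.assoc)
    then show ?case by blast
  next
    case (mult a b)
    then show ?case by (metis mult.assoc)
  next
    case (add a b)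
    then show ?case by (metis distrib_left poly_y_add)
  next
    case (scale c a)
    then show ?case by (metis S1_scale_mult_right poly_y_smult)
  qed
  from this[of "[:1:]"] show ?thesis by simp
qed

text \<open>Powers of y commute with polynomials in y, so exponents that work for two elements add
  up to one for their product and sum.\<close>

lemma S1_y_power_mult_eq_poly_y: "\<exists>n g. S1_y ^ n * a = poly_y g"
proof (induction a rule: S1_induct)
  case one
  have "S1_y ^ 0 * 1 = poly_y [:1:]" by simp
  then show ?case by blast
next
  case x
  have "S1_y ^ 1 * S1_x = poly_y [:1:]" by (simp add: S1_yx)
  then show ?case by blast
next
  case y
  have "S1_y ^ 0 * S1_y = poly_y [:0, 1:]" by simp
  then show ?case by blast
next
  case (mult a b)
  then obtain m f n g where f: "S1_y ^ m * a = poly_y f" and g: "S1_y ^ n * b = poly_y g"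
    by blast
  have "S1_y ^ (n + m) * (a * b) = S1_y ^ n * (S1_y ^ m * a) * b"
    by (simp add: power_add mult.assoc)
  also have "\<dots> = poly_y (f * g)"
    by (metis f g poly_y_power_commute poly_y_mult mult.assoc)
  finally show ?case by blast
next
  case (add a b)
  then obtain m f n g where f: "S1_y ^ m * a = poly_y f" and g: "S1_y ^ n * b = poly_y g"
    by blast
  have "S1_y ^ (n + m) * (a + b) = S1_y ^ n * (S1_y ^ m * a) + S1_y ^ m * (S1_y ^ n * b)"
    by (simp add: distrib_left flip: mult.assoc power_add) (simp add: add.commute)
  also have "\<dots> = poly_y (monom 1 n * f + monom 1 m * g)"
    by (simp add: f g poly_y_add poly_y_mult poly_y_monom)
  finally show ?case by blast
next
  case (scale c a)
  then show ?case by (metis S1_scale_mult_right poly_y_smult)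
qed

section \<open>Left regular elements\<close>

text \<open>If every e y^k r vanished, a power y^n with y^n r = g(y) would give e g(y) = 0, hence
  y^n r = 0, and telescoping would leave r = 0.\<close>

lemma S1_e_y_power_mult_nonzero:
  fixes r :: "'k::field S1"
  assumes "r \<noteq> 0" shows "\<exists>k. S1_e * (S1_y ^ k * r) \<noteq> 0"
proof (rule ccontr)
  assume "\<not> ?thesis"
  then have zero: "S1_e * (S1_y ^ k * r) = 0" for k by blast
  obtain n g where g: "S1_y ^ n * r = poly_y g"
    using S1_y_power_mult_eq_poly_y by blast
  then have "g = 0" using zero[of n] by (simp add: S1_e_poly_y_eq_0_iff)
  then show False using S1_telescope[of r n] zero g assms by simp
qed

lemma poly_y_left_regular:
  assumes "p \<noteq> 0" shows "poly_y p \<in> left_regular"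
proof -
  have "r = 0" if r: "r * poly_y p = 0" for r
  proof (rule ccontr)
    assume "r \<noteq> 0"
    then obtain k where k: "S1_e * (S1_y ^ k * r) \<noteq> 0"
      using S1_e_y_power_mult_nonzero by blast
    obtain g where g: "S1_e * (S1_y ^ k * r) = S1_e * poly_y g"
      using S1_e_mult_eq_poly_y by blast
    have "S1_e * poly_y (g * p) = S1_e * (S1_y ^ k * (r * poly_y p))"
      by (metis g mult.assoc poly_y_mult)
    then have "g * p = 0" using r by (simp add: S1_e_poly_y_eq_0_iff)
    then show False using k g assms by simp
  qed
  then show ?thesis by (simp add: left_regular_def)
qed

lemma S1_x_power_e_mult_in_F: "S1_x ^ k * (S1_e * a) \<in> S1_F"
proof -
  \<comment> \<open>Since e a = e g(y) for some g, polynomials suffice; \<open>S1_y ^ j\<close>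
    absorbs the y released by each Horner step.\<close>
  have "S1_x ^ k * (S1_e * (S1_y ^ j * poly_y g)) \<in> S1_F" for j g
  proof (induction g arbitrary: j)
    case 0
    show ?case by (simp add: S1_F_def S1.span_zero)
  next
    case (pCons c g)
    have "S1_x ^ k * (S1_e * (S1_y ^ j * poly_y (pCons c g)))
        = S1_scale c (S1_E k j) + S1_x ^ k * (S1_e * (S1_y ^ Suc j * poly_y g))"
      by (simp add: S1_E_eq distrib_left S1_scale_mult_left S1_scale_mult_right mult.assoc
          poly_y_commute power_Suc2 del: power_Suc)
    moreover have "S1_scale c (S1_E k j) \<in> S1_F"
      unfolding S1_F_def by (intro S1.span_scale S1.span_base) blast
    ultimately show ?case
      using pCons.IH[of "Suc j"] by (simp add: S1_F_def S1.span_add)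
  qed
  from this[of 0] show ?thesis using S1_e_mult_eq_poly_y[of a] by auto
qed

lemma S1_F_if_y_power_mult_eq_0:
  assumes "S1_y ^ n * a = 0" shows "a \<in> S1_F"
proof -
  have "a = (\<Sum>k<n. S1_x ^ k * (S1_e * (S1_y ^ k * a)))"
    using S1_telescope[of a n] assms by simp
  also have "\<dots> \<in> S1_F"
    using S1_x_power_e_mult_in_F unfolding S1_F_def by (intro S1.span_sum) blast
  finally show ?thesis .
qed

lemma y_power_mult_eq_0_if_S1_F:
  assumes "a \<in> S1_F" shows "\<exists>n. S1_y ^ n * a = 0"
  using assms unfolding S1_F_def
proof (induction rule: S1.span_induct_alt)
  case base
  show ?case by simp
next
  case (step c b a)
  then obtain i j n where b: "b = S1_E i j" and n: "S1_y ^ n * a = 0" by blast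
  \<comment> \<open>\<open>S1_y ^ i\<close> cancels \<open>S1_x ^ i\<close>, and the one extra y
    then annihilates e.\<close>
  have "S1_y ^ Suc i * b = S1_y * (S1_y ^ i * S1_x ^ i) * S1_e * S1_y ^ j"
    by (simp add: b S1_E_eq mult.assoc)
  then have "S1_y ^ Suc i * b = 0" by (simp add: S1_y_power_x_power S1_y_e)
  then have "S1_y ^ (n + Suc i) * b = 0"
    by (simp only: power_add mult.assoc mult_zero_right)
  moreover have "S1_y ^ (Suc i + n) * a = 0"
    by (simp only: power_add mult.assoc n mult_zero_right)
  ultimately have "S1_y ^ (n + Suc i) * (S1_scale c b + a) = 0"
    by (simp only: distrib_left S1_scale_mult_right add.commute) simp
  then show ?case by blast
qed

lemma ex_y_power_mult_left_regular:
  assumes "a \<notin> S1_F" shows "\<exists>i. S1_y ^ i * a \<in> left_regular"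
proof -
  obtain n g where g: "S1_y ^ n * a = poly_y g"
    using S1_y_power_mult_eq_poly_y by blast
  then have "g \<noteq> 0" using S1_F_if_y_power_mult_eq_0 assms by fastforce
  then show ?thesis using g poly_y_left_regular by metis
qed

lemma left_regular_not_in_F:
  fixes c :: "'k::field S1"
  assumes "c \<in> left_regular" shows "c \<notin> S1_F"
proof
  assume "c \<in> S1_F"
  then obtain n where "S1_y ^ n * c = 0" using y_power_mult_eq_0_if_S1_F by blast
  then have "S1_y ^ n = (0 :: 'k S1)" using assms by (simp add: left_regular_def)
  \<comment> \<open>\<open>S1_x ^ n\<close> is a right inverse of \<open>S1_y ^ n\<close>, which
    therefore cannot be 0.\<close>
  then show False using S1_y_power_x_power[of n, where 'k = 'k] by simp
qed

lemma S1_d_left_regular: "c \<in> left_regular \<Longrightarrow> S1_d c = 0"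
  by (simp add: S1_d_def Least_eq_0)

section \<open>Right regular elements\<close>

lemma S1_eta_mult: "S1_eta (a * b) = S1_eta b * S1_eta a"
  using S1_eta_anti_automorphism unfolding S1_anti_automorphism_def by blast

lemma S1_eta_eq_0_iff: "S1_eta a = 0 \<longleftrightarrow> a = 0"
  by (metis S1_eta_S1_eta S1_eta_mult mult_zero_left mult_zero_right)

text \<open>Reversal of products turns \<open>r * c\<close> into \<open>S1_eta c * S1_eta r\<close>,
  and since \<open>S1_eta\<close> is an involution every right factor arises this way.\<close>

lemma S1_eta_right_regular_iff: "S1_eta c \<in> right_regular \<longleftrightarrow> c \<in> left_regular"
  unfolding left_regular_def right_regular_def mem_Collect_eq
  by (metis S1_eta_S1_eta S1_eta_mult S1_eta_eq_0_iff)

theorem theorem3p16: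
  shows "(left_regular :: 'k::field S1 set) = {S1_y ^ S1_d a * a | a. a \<notin> S1_F} \<and>
    (right_regular :: 'k S1 set) = S1_eta ` left_regular"
proof
  show "(left_regular :: 'k S1 set) = {S1_y ^ S1_d a * a | a. a \<notin> S1_F}"
  proof (intro set_eqI iffI)
    fix c :: "'k S1"
    assume c: "c \<in> left_regular"
    \<comment> \<open>The exponent 0 makes \<open>c\<close> its own witness.\<close>
    then have "c = S1_y ^ S1_d c * c" by (simp add: S1_d_left_regular)
    then show "c \<in> {S1_y ^ S1_d a * a | a. a \<notin> S1_F}"
      using left_regular_not_in_F[OF c] by blast
  next
    fix c :: "'k S1"
    assume "c \<in> {S1_y ^ S1_d a * a | a. a \<notin> S1_F}"
    then show "c \<in> left_regular"
      using LeastI_ex[OF ex_y_power_mult_left_regular] by (auto simp: S1_d_def)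
  qed
  show "(right_regular :: 'k S1 set) = S1_eta ` left_regular"
    by (metis (no_types, lifting) S1_eta_S1_eta S1_eta_right_regular_iff image_iff subsetI subset_antisym)
qed

end
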